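(* There exist an Ahlfors $2$-regular metric space $X$ which is homeomorphic to $\mathbb{R}^2$, a quasiconformal homeomorphism $F:X\to\mathbb{R}^2$, and a cofat domain $\Omega\subset X$, such that $F(\Omega)\subset\mathbb{R}^2$ is not cofat.
   Context: $\mathcal{H}^2$ is two-dimensional Hausdorff measure (normalized to agree with Lebesgue measure on $\mathbb{R}^2$), and $\mathbb{R}^2$ carries the Euclidean metric. $X$ is Ahlfors $2$-regular if there is $\alpha\ge1$ with $\alpha^{-1}R^2\le\mathcal{H}^2(B(x,R))\le\alpha R^2$ for all $x\in X$ and $0<R<\operatorname{diam}(X)$, where $B(x,R)$ is the open ball. A set $A\subset X$ is $\tau$-fat if for every $x_0\in A$ and every open ball $B(x_0,r)\subset X$ that does not contain $A$, $\mathcal{H}^2(A\cap B(x_0,r))\ge\tau r^2$. A domain $\Omega\subset X$ is cofat if there is $\tau>0$ such that every connected component of $X\setminus\Omega$ with positive diameter is $\tau$-fat. The conformal modulus of a curve family $\Gamma$ in $X$ is $\operatorname{mod}_{\mathrm C}(\Gamma)=\inf_\rho\int_X\rho^2\,d\mathcal{H}^2$, where the infimum is over all Borel functions $\rho:X\to[0,\infty]$ with $\int_\gamma\rho\,ds\ge1$ for every locally rectifiable $\gamma\in\Gamma$. A homeomorphism $F$ is quasiconformal if there is $K\ge1$ such that $K^{-1}\operatorname{mod}_{\mathrm C}(\Gamma)\le\operatorname{mod}_{\mathrm C}(F\Gamma)\le K\operatorname{mod}_{\mathrm C}(\Gamma)$ for every curve family $\Gamma$ in its domain of definition, where $F\Gamma=\{F\circ\gamma:\gamma\in\Gamma\}$.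 *)

theory Defs
  imports "HOL-Analysis.Analysis"
begin

text \<open>Metric spaces are values of the library type \<open>'a metric\<close>, with carrier \<^term>\<open>mspace X\<close>,
  distance \<^term>\<open>mdist X\<close> and topology \<^term>\<open>mtopology_of X\<close>. Quantities that may be infinite live in
  \<^typ>\<open>ennreal\<close>, where the infimum of the empty set is infinite and its supremum is 0.\<close>

definition mdiam :: "'a metric \<Rightarrow> 'a set \<Rightarrow> ennreal" where
  "mdiam X A = (SUP x\<in>A. SUP y\<in>A. ennreal (mdist X x y))"

definition hausdorff2_content :: "'a metric \<Rightarrow> real \<Rightarrow> 'a set \<Rightarrow> ennreal" where
  "hausdorff2_content X \<delta> A =
     (INF E \<in> {E :: nat \<Rightarrow> 'a set. A \<subseteq> (\<Union>i. E i) \<and>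
                 (\<forall>i. E i \<subseteq> mspace X \<and> mdiam X (E i) \<le> ennreal \<delta>)}.
        (\<Sum>i. ennreal (pi / 4) * (mdiam X (E i))\<^sup>2))"

text \<open>The factor \<open>pi/4\<close> above is the area of a planar disc of diameter 1; with it,
  two-dimensional Hausdorff measure on the Euclidean plane is Lebesgue measure.\<close>

definition hausdorff2 :: "'a metric \<Rightarrow> 'a set \<Rightarrow> ennreal" where
  "hausdorff2 X A = (SUP \<delta>\<in>{0<..}. hausdorff2_content X \<delta> A)"

text \<open>\<^const>\<open>hausdorff2\<close> is a metric outer measure, hence countably additive on the Borel sets;
  the following is its restriction to them.\<close>

definition hausdorff2_measure :: "'a metric \<Rightarrow> 'a measure" where
  "hausdorff2_measure X = measure_of (mspace X) {U. openin (mtopology_of X) U} (hausdorff2 X)"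

definition ahlfors_2_regular :: "'a metric \<Rightarrow> bool" where
  "ahlfors_2_regular X \<longleftrightarrow>
     (\<exists>\<alpha>::real. \<alpha> \<ge> 1 \<and>
        (\<forall>x\<in>mspace X. \<forall>R::real. 0 < R \<and> ennreal R < mdiam X (mspace X) \<longrightarrow>
           ennreal (R\<^sup>2 / \<alpha>) \<le> hausdorff2 X (mball_of X x R) \<and>
           hausdorff2 X (mball_of X x R) \<le> ennreal (\<alpha> * R\<^sup>2)))"

definition domain_in :: "'a metric \<Rightarrow> 'a set \<Rightarrow> bool" where
  "domain_in X \<Omega> \<longleftrightarrow>
     \<Omega> \<noteq> {} \<and> openin (mtopology_of X) \<Omega> \<and> connectedin (mtopology_of X) \<Omega>"

definition fat :: "'a metric \<Rightarrow> real \<Rightarrow> 'a set \<Rightarrow> bool" where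
  "fat X \<tau> A \<longleftrightarrow>
     (\<forall>x\<in>A. \<forall>r>0. \<not> A \<subseteq> mball_of X x r \<longrightarrow>
        ennreal (\<tau> * r\<^sup>2) \<le> hausdorff2 X (A \<inter> mball_of X x r))"

definition cofat :: "'a metric \<Rightarrow> 'a set \<Rightarrow> bool" where
  "cofat X \<Omega> \<longleftrightarrow>
     (\<exists>\<tau>>0. \<forall>A \<in> connected_components_of (subtopology (mtopology_of X) (mspace X - \<Omega>)).
        0 < mdiam X A \<longrightarrow> fat X \<tau> A)"

text \<open>A curve is a continuous map from a (not necessarily compact) interval. It is encoded as a
  pair of the interval and a function on the reals, whose values off the interval are never used.\<close>

type_synonym 'a curve = "real set \<times> (real \<Rightarrow> 'a)"

definition curves :: "'a metric \<Rightarrow> 'a curve set" where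
  "curves X = {(I, \<gamma>). is_interval I \<and> I \<noteq> {} \<and> continuous_map (top_of_set I) (mtopology_of X) \<gamma>}"

definition curve_length :: "'a metric \<Rightarrow> (real \<Rightarrow> 'a) \<Rightarrow> real \<Rightarrow> real \<Rightarrow> ennreal" where
  "curve_length X \<gamma> a b =
     (SUP (n, t) \<in> {(n :: nat, t :: nat \<Rightarrow> real). mono t \<and> range t \<subseteq> {a..b}}.
        \<Sum>i<n. ennreal (mdist X (\<gamma> (t i)) (\<gamma> (t (Suc i)))))"

definition locally_rectifiable :: "'a metric \<Rightarrow> 'a curve \<Rightarrow> bool" where
  "locally_rectifiable X = (\<lambda>(I, \<gamma>).
     \<forall>a b. a \<le> b \<and> {a..b} \<subseteq> I \<longrightarrow> curve_length X \<gamma> a b < \<infinity>)"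

text \<open>Arc length parametrization of a rectifiable curve on \<open>[a, b]\<close>, as a function on
  \<open>[0, length]\<close>. The choice is immaterial: a curve is constant wherever
  its length function is.\<close>

definition arc_param :: "'a metric \<Rightarrow> (real \<Rightarrow> 'a) \<Rightarrow> real \<Rightarrow> real \<Rightarrow> real \<Rightarrow> 'a" where
  "arc_param X \<gamma> a b s = \<gamma> (SOME t. t \<in> {a..b} \<and> curve_length X \<gamma> a t = ennreal s)"

text \<open>Integral with respect to arc length over a locally rectifiable curve: the supremum of the
  integrals over its compact subcurves.\<close>

definition line_integral :: "'a metric \<Rightarrow> ('a \<Rightarrow> ennreal) \<Rightarrow> 'a curve \<Rightarrow> ennreal" where
  "line_integral X \<rho> = (\<lambda>(I, \<gamma>).
     (SUP (a, b) \<in> {(a, b). a \<le> b \<and> {a..b} \<subseteq> I}.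
        (\<integral>\<^sup>+ s \<in> {0..enn2real (curve_length X \<gamma> a b)}. \<rho> (arc_param X \<gamma> a b s) \<partial>lborel)))"

definition admissible :: "'a metric \<Rightarrow> 'a curve set \<Rightarrow> ('a \<Rightarrow> ennreal) \<Rightarrow> bool" where
  "admissible X \<Gamma> \<rho> \<longleftrightarrow>
     \<rho> \<in> borel_measurable (hausdorff2_measure X) \<and>
     (\<forall>c\<in>\<Gamma>. locally_rectifiable X c \<longrightarrow> 1 \<le> line_integral X \<rho> c)"

definition conformal_modulus :: "'a metric \<Rightarrow> 'a curve set \<Rightarrow> ennreal" where
  "conformal_modulus X \<Gamma> =
     (INF \<rho> \<in> {\<rho>. admissible X \<Gamma> \<rho>}. \<integral>\<^sup>+ x. (\<rho> x)\<^sup>2 \<partial>hausdorff2_measure X)"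

definition image_family :: "('a \<Rightarrow> 'b) \<Rightarrow> 'a curve set \<Rightarrow> 'b curve set" where
  "image_family F \<Gamma> = (\<lambda>(I, \<gamma>). (I, F \<circ> \<gamma>)) ` \<Gamma>"

definition quasiconformal_homeo :: "'a metric \<Rightarrow> 'b metric \<Rightarrow> ('a \<Rightarrow> 'b) \<Rightarrow> bool" where
  "quasiconformal_homeo X Y F \<longleftrightarrow>
     homeomorphic_map (mtopology_of X) (mtopology_of Y) F \<and>
     (\<exists>K::real. K \<ge> 1 \<and>
        (\<forall>\<Gamma> \<subseteq> curves X.
           ennreal (1 / K) * conformal_modulus X \<Gamma> \<le> conformal_modulus Y (image_family F \<Gamma>) \<and>
           conformal_modulus Y (image_family F \<Gamma>) \<le> ennreal K * conformal_modulus X \<Gamma>))"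

text \<open>The Euclidean plane. A metric space homeomorphic to it has the cardinality of the
  continuum, so up to isometry its carrier may be taken to be a set of elements of \<^typ>\<open>real^2\<close>
  (with an arbitrary, unrelated metric).\<close>

abbreviation plane :: "(real^2) metric" where
  "plane \<equiv> euclidean_metric"

end

theory Submission
  imports Defs
begin

text \<open>Fatness of a set is tested with metric balls, while quasiconformality only sees lengths and
  areas, which are local. The example exploits this gap: \<open>X\<close> is the plane with the metric
  \<open>d(x, y) = min |x - y| (1 + |x - \<sigma> y|)\<close>, where \<open>\<sigma>\<close> is the reflection in the vertical axis. Thus
  the right half-plane is folded over the left one and held at distance 1 from it. Below scale 1 the
  metric \<open>d\<close> is the Euclidean one. Hence \<open>X\<close> and the plane have the same topology, Hausdorff
  measure, curve lengths and moduli, and the identity is quasiconformal with \<open>K = 1\<close>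
  (\<open>agree_below_quasiconformal_id\<close>). A ball of \<open>X\<close> contains the Euclidean ball of the
  same radius and lies in the union of two such balls, so \<open>X\<close> is Ahlfors 2-regular.

  The complement of \<open>\<Omega>\<close> is a connected comb: the left half-plane together with horizontal teeth of
  length \<open>n\<close> and height 2 in the right half-plane, around the heights \<open>n\<^sup>2\<close>. In the
  plane the disc of radius \<open>n\<close> around the tip of the \<open>n\<close>-th tooth meets the comb in that tooth only,
  in an area of order \<open>n\<close>, which is negligible against \<open>n\<^sup>2\<close>; the comb is
  not fat (\<open>not_fat_comb_plane\<close>). In \<open>X\<close>, a ball of bounded radius around a point of a tooth
  sees enough of the tooth itself, and a larger ball reaches through the fold and contains a large
  piece of the left half-plane (\<open>fat_comb_folded_plane\<close>). The teeth are all of finite length so that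
  the complement of the comb is connected.\<close>

section \<open>Metrics that agree at small scales\<close>

definition agree_below :: "real \<Rightarrow> 'a metric \<Rightarrow> 'a metric \<Rightarrow> bool" where
  "agree_below \<epsilon> X Y \<longleftrightarrow> mspace X = mspace Y \<and>
     (\<forall>x\<in>mspace X. \<forall>y\<in>mspace X. mdist X x y < \<epsilon> \<or> mdist Y x y < \<epsilon> \<longrightarrow> mdist X x y = mdist Y x y)"

lemma agree_below_sym: "agree_below \<epsilon> X Y \<Longrightarrow> agree_below \<epsilon> Y X"
  unfolding agree_below_def by metis

lemma agree_below_mspace: "agree_below \<epsilon> X Y \<Longrightarrow> mspace X = mspace Y"
  unfolding agree_below_def by blast

lemma openin_mtopology_of:
  "openin (mtopology_of X) U \<longleftrightarrow>
     U \<subseteq> mspace X \<and> (\<forall>x\<in>U. \<exists>r>0. \<forall>y\<in>mspace X. mdist X x y < r \<longrightarrow> y \<in> U)"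
proof -
  interpret Metric_space "mspace X" "mdist X" by (rule Metric_space_mspace_mdist)
  have "mball x r \<subseteq> U \<longleftrightarrow> (\<forall>y\<in>mspace X. mdist X x y < r \<longrightarrow> y \<in> U)"
    if "U \<subseteq> mspace X" "x \<in> U" for x r
    using that by (auto simp: subset_iff)
  then show ?thesis
    unfolding mtopology_of_def openin_mtopology by (metis (no_types, lifting))
qed

lemma agree_below_mtopology_of:
  assumes "agree_below \<epsilon> X Y" "\<epsilon> > 0"
  shows "mtopology_of X = mtopology_of Y"
proof -
  have *: "openin (mtopology_of Y) U"
    if XY: "agree_below \<epsilon> X Y" and U: "openin (mtopology_of X) U" for X Y :: "'a metric" and U
    unfolding openin_mtopology_of
  proof (intro conjI ballI)
    show "U \<subseteq> mspace Y" using U XY agree_below_mspace unfolding openin_mtopology_of by blast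
    fix x assume "x \<in> U"
    then obtain r where "r > 0" "\<forall>y\<in>mspace X. mdist X x y < r \<longrightarrow> y \<in> U" "x \<in> mspace X"
      using U unfolding openin_mtopology_of by blast
    moreover have "mdist X x y = mdist Y x y" if "y \<in> mspace X" "mdist Y x y < \<epsilon>" for y
      using XY that \<open>x \<in> mspace X\<close> unfolding agree_below_def by blast
    ultimately have "\<forall>y\<in>mspace Y. mdist Y x y < min r \<epsilon> \<longrightarrow> y \<in> U"
      using agree_below_mspace[OF XY] by auto
    then show "\<exists>r>0. \<forall>y\<in>mspace Y. mdist Y x y < r \<longrightarrow> y \<in> U"
      using \<open>r > 0\<close> \<open>\<epsilon> > 0\<close> by (intro exI[of _ "min r \<epsilon>"]) auto
  qed
  show ?thesis
    unfolding topology_eq using *[OF assms(1)] *[OF agree_below_sym[OF assms(1)]] by blast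
qed

lemma mdist_le_mdiam:
  "x \<in> E \<Longrightarrow> y \<in> E \<Longrightarrow> ennreal (mdist X x y) \<le> mdiam X E"
  unfolding mdiam_def by (meson SUP_upper2 SUP_upper)

lemma agree_below_mdiam:
  assumes "agree_below \<epsilon> X Y" "E \<subseteq> mspace X" "mdiam X E \<le> ennreal \<delta>" "\<delta> < \<epsilon>"
  shows "mdiam Y E = mdiam X E"
proof -
  have "mdist X x y = mdist Y x y" if "x \<in> E" "y \<in> E" for x y
  proof -
    have "ennreal (mdist X x y) \<le> ennreal \<delta>"
      using mdist_le_mdiam[OF that, of X] assms(3) by order
    then have le: "mdist X x y \<le> max \<delta> 0"
      unfolding ennreal_le_iff2 by linarith
    have xy: "x \<in> mspace X" "y \<in> mspace X" "mspace X = mspace Y"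
      using that assms(2) agree_below_mspace[OF assms(1)] by auto
    show ?thesis
    proof (cases "\<delta> \<ge> 0")
      case True
      then have "mdist X x y < \<epsilon>" using le assms(4) by simp
      then show ?thesis using assms(1) xy unfolding agree_below_def by blast
    next
      case False
      then have "mdist X x y = 0" using le mdist_nonneg[of X x y] by simp
      moreover from this have "mdist Y x y = 0"
        unfolding mdist_zero[OF xy(1,2)] mdist_zero[OF xy(1,2)[unfolded xy(3)]] .
      ultimately show ?thesis by simp
    qed
  qed
  then show ?thesis unfolding mdiam_def by (simp cong: SUP_cong)
qed

lemma hausdorff2_content_antimono:
  fixes X :: "'a metric"
  assumes "\<delta> \<le> \<delta>'"
  shows "hausdorff2_content X \<delta>' A \<le> hausdorff2_content X \<delta> A"
  unfolding hausdorff2_content_def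
proof (rule INF_superset_mono)
  have "ennreal \<delta> \<le> ennreal \<delta>'" using assms by (rule ennreal_leI)
  then show "{E. A \<subseteq> (\<Union>i. E i) \<and> (\<forall>i. E i \<subseteq> mspace X \<and> mdiam X (E i) \<le> ennreal \<delta>)}
      \<subseteq> {E :: nat \<Rightarrow> 'a set. A \<subseteq> (\<Union>i. E i) \<and> (\<forall>i. E i \<subseteq> mspace X \<and> mdiam X (E i) \<le> ennreal \<delta>')}"
    by (auto intro: order_trans)
qed simp

lemma agree_below_hausdorff2_content_le:
  fixes X Y :: "'a metric"
  assumes "agree_below \<epsilon> X Y" "\<delta> < \<epsilon>"
  shows "hausdorff2_content X \<delta> A \<le> hausdorff2_content Y \<delta> A"
proof -
  have le: "hausdorff2_content X \<delta> A \<le> (\<Sum>i. ennreal (pi / 4) * (mdiam Y (E i))\<^sup>2)"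
    if "A \<subseteq> (\<Union>i. E i)" and E: "\<And>i. E i \<subseteq> mspace Y \<and> mdiam Y (E i) \<le> ennreal \<delta>" for E :: "nat \<Rightarrow> _"
  proof -
    have "mdiam X (E i) = mdiam Y (E i)" for i
      using agree_below_mdiam[OF agree_below_sym[OF assms(1)]] E assms(2) by blast
    then show ?thesis
      unfolding hausdorff2_content_def using that agree_below_mspace[OF assms(1)]
      by (intro INF_lower2[of E]) auto
  qed
  show ?thesis
    unfolding hausdorff2_content_def[of Y]
  proof (rule INF_greatest)
    fix E assume "E \<in> {E :: nat \<Rightarrow> 'a set. A \<subseteq> (\<Union>i. E i) \<and>
      (\<forall>i. E i \<subseteq> mspace Y \<and> mdiam Y (E i) \<le> ennreal \<delta>)}"
    then show "hausdorff2_content X \<delta> A \<le> (\<Sum>i. ennreal (pi / 4) * (mdiam Y (E i))\<^sup>2)"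
      unfolding mem_Collect_eq by (elim conjE) (rule le, assumption, erule spec)
  qed
qed

text \<open>Hausdorff measure is the limit of contents over covers by small sets, and the diameters of
  small sets agree.\<close>

lemma agree_below_hausdorff2:
  assumes "agree_below \<epsilon> X Y" "\<epsilon> > 0"
  shows "hausdorff2 X = hausdorff2 Y"
proof -
  have *: "hausdorff2 X A \<le> hausdorff2 Y A" if "agree_below \<epsilon> X Y" for X Y :: "'a metric" and A
    unfolding hausdorff2_def
  proof (rule SUP_mono)
    fix \<delta> :: real assume "\<delta> \<in> {0<..}"
    define \<eta> where "\<eta> = min \<delta> (\<epsilon> / 2)"
    have "hausdorff2_content X \<delta> A \<le> hausdorff2_content X \<eta> A"
      by (rule hausdorff2_content_antimono) (simp add: \<eta>_def)
    also have "\<dots> \<le> hausdorff2_content Y \<eta> A"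
      by (rule agree_below_hausdorff2_content_le[OF that]) (use \<open>\<epsilon> > 0\<close> in \<open>simp add: \<eta>_def\<close>)
    finally show "\<exists>\<eta>\<in>{0<..}. hausdorff2_content X \<delta> A \<le> hausdorff2_content Y \<eta> A"
      using \<open>\<delta> \<in> {0<..}\<close> \<open>\<epsilon> > 0\<close> by (intro bexI[of _ \<eta>]) (auto simp: \<eta>_def)
  qed
  show ?thesis
    by (rule ext, rule antisym) (rule *[OF assms(1)], rule *[OF agree_below_sym[OF assms(1)]])
qed

lemma agree_below_hausdorff2_measure:
  assumes "agree_below \<epsilon> X Y" "\<epsilon> > 0"
  shows "hausdorff2_measure X = hausdorff2_measure Y"
  unfolding hausdorff2_measure_def agree_below_mspace[OF assms(1)]
    agree_below_mtopology_of[OF assms] agree_below_hausdorff2[OF assms] by simp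

text \<open>Dividing every step of the partition \<open>t\<close> into \<open>m\<close> equal parts gives a partition with arbitrarily
  small jumps, whose polygonal length is at least that of \<open>t\<close> for any metric, by the triangle
  inequality.\<close>

lemma refine_partition:
  fixes \<gamma> :: "real \<Rightarrow> 'a::metric_space" and t :: "nat \<Rightarrow> real"
  assumes \<gamma>: "continuous_on {a..b} \<gamma>" and "\<epsilon> > 0" and t: "mono t" "range t \<subseteq> {a..b}"
  shows "\<exists>N s. mono s \<and> range s \<subseteq> {a..b} \<and> (\<forall>k. dist (\<gamma> (s k)) (\<gamma> (s (Suc k))) < \<epsilon>) \<and>
    (\<forall>X :: 'a metric. mspace X = UNIV \<longrightarrow>
        (\<Sum>i<n. ennreal (mdist X (\<gamma> (t i)) (\<gamma> (t (Suc i)))))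
        \<le> (\<Sum>k<N. ennreal (mdist X (\<gamma> (s k)) (\<gamma> (s (Suc k))))))"
proof -
  have tab: "t i \<in> {a..b}" for i using t(2) by blast
  have tmono: "t i \<le> t (Suc i)" for i using t(1) by (simp add: monoD)
  have "uniformly_continuous_on {a..b} \<gamma>"
    using \<gamma> compact_uniformly_continuous by blast
  then obtain \<delta> where "\<delta> > 0" and
    \<delta>: "\<And>x y. x \<in> {a..b} \<Longrightarrow> y \<in> {a..b} \<Longrightarrow> dist x y < \<delta> \<Longrightarrow> dist (\<gamma> x) (\<gamma> y) < \<epsilon>"
    unfolding uniformly_continuous_on_def using \<open>\<epsilon> > 0\<close> by (metis dist_commute)
  obtain m :: nat where m: "(b - a) / \<delta> < real m" using reals_Archimedean2 by blast
  have "a \<le> b" using tab[of 0] by simp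
  have "m > 0" using m \<open>\<delta> > 0\<close> \<open>a \<le> b\<close> by (auto intro!: Nat.gr0I simp: divide_less_0_iff)
  define s where "s = (\<lambda>k. t (k div m) + real (k mod m) / real m * (t (Suc (k div m)) - t (k div m)))"
  \<comment> \<open>The case \<open>j = m\<close> is included, so that adjacent steps of \<open>t\<close> match at their common point.\<close>
  have s_grid: "s (m * i + j) = t i + real j / real m * (t (Suc i) - t i)" if "j \<le> m" for i j
  proof (cases "j = m")
    case True
    have "m * i + m = m * Suc i" by simp
    then show ?thesis unfolding s_def True using \<open>m > 0\<close> by (simp only: mod_mult_self1_is_0 nonzero_mult_div_cancel_left) simp
  qed (use that \<open>m > 0\<close> in \<open>auto simp: s_def\<close>)
  have step: "s (Suc k) - s k = (t (Suc (k div m)) - t (k div m)) / real m" for k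
  proof -
    have "k mod m < m" using \<open>m > 0\<close> by simp
    then have "s (m * (k div m) + Suc (k mod m)) - s (m * (k div m) + k mod m)
        = (t (Suc (k div m)) - t (k div m)) / real m"
      by (subst (1 2) s_grid) (use \<open>m > 0\<close> in \<open>auto simp: field_simps Suc_le_eq\<close>)
    then show ?thesis by simp
  qed
  have s_mono: "mono s"
    unfolding mono_iff_le_Suc
  proof
    fix k
    have "0 \<le> s (Suc k) - s k" unfolding step using tmono[of "k div m"] by simp
    then show "s k \<le> s (Suc k)" by simp
  qed
  have s_range: "s k \<in> {a..b}" for k
  proof -
    have "k mod m \<le> m" using \<open>m > 0\<close> by (simp add: less_imp_le)
    then have "real (k mod m) / real m \<in> {0..1}"
      using \<open>m > 0\<close> by simp
    then have "0 \<le> real (k mod m) / real m * (t (Suc (k div m)) - t (k div m))"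
      "real (k mod m) / real m * (t (Suc (k div m)) - t (k div m)) \<le> t (Suc (k div m)) - t (k div m)"
      using tmono[of "k div m"] by (simp_all only: mult_left_le_one_le mult_nonneg_nonneg atLeastAtMost_iff diff_ge_0_iff_ge)
    then have "t (k div m) \<le> s k \<and> s k \<le> t (Suc (k div m))"
      unfolding s_def by linarith
    then show ?thesis using tab[of "k div m"] tab[of "Suc (k div m)"] by auto
  qed
  show ?thesis
  proof (intro exI[of _ "n * m"] exI[of _ s] conjI allI impI)
    show "mono s" by (fact s_mono)
    show "range s \<subseteq> {a..b}" using s_range by blast
    show "dist (\<gamma> (s k)) (\<gamma> (s (Suc k))) < \<epsilon>" for k
    proof (rule \<delta>[OF s_range s_range])
      have "dist (s k) (s (Suc k)) = (t (Suc (k div m)) - t (k div m)) / real m"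
        using step[of k] monoD[OF s_mono, of k "Suc k"] by (simp add: dist_real_def)
      also have "\<dots> \<le> (b - a) / real m"
        using tab[of "k div m"] tab[of "Suc (k div m)"] by (intro divide_right_mono) auto
      also have "\<dots> < \<delta>" using m \<open>\<delta> > 0\<close> \<open>m > 0\<close> by (simp add: field_simps)
      finally show "dist (s k) (s (Suc k)) < \<delta>" .
    qed
    fix X :: "'a metric" assume X: "mspace X = UNIV"
    have tri: "mdist X (\<gamma> (s p)) (\<gamma> (s (p + j))) \<le> (\<Sum>k\<in>{p..<p+j}. mdist X (\<gamma> (s k)) (\<gamma> (s (Suc k))))" for p j
    proof (induction j)
      case 0
      have "mdist X (\<gamma> (s p)) (\<gamma> (s p)) = 0" by (subst mdist_zero) (simp_all add: X)
      then show ?case by simp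
    next
      case (Suc j)
      have "mdist X (\<gamma> (s p)) (\<gamma> (s (p + Suc j)))
          \<le> mdist X (\<gamma> (s p)) (\<gamma> (s (p + j))) + mdist X (\<gamma> (s (p + j))) (\<gamma> (s (p + Suc j)))"
        by (rule mdist_triangle) (auto simp: X)
      then show ?case using Suc by simp
    qed
    have "(\<Sum>i<n. mdist X (\<gamma> (t i)) (\<gamma> (t (Suc i))))
        \<le> (\<Sum>i<n. \<Sum>k\<in>{i*m..<i*m+m}. mdist X (\<gamma> (s k)) (\<gamma> (s (Suc k))))"
    proof (rule sum_mono)
      fix i
      have "s (i * m) = t i" "s (i * m + m) = t (Suc i)"
        using s_grid[of 0 i] s_grid[of m i] \<open>m > 0\<close> by (simp_all add: mult.commute)
      then show "mdist X (\<gamma> (t i)) (\<gamma> (t (Suc i)))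
          \<le> (\<Sum>k\<in>{i*m..<i*m+m}. mdist X (\<gamma> (s k)) (\<gamma> (s (Suc k))))"
        using tri[of "i * m" m] by simp
    qed
    also have "\<dots> = (\<Sum>k<n*m. mdist X (\<gamma> (s k)) (\<gamma> (s (Suc k))))"
      by (rule sum.nat_group)
    finally show "(\<Sum>i<n. ennreal (mdist X (\<gamma> (t i)) (\<gamma> (t (Suc i)))))
        \<le> (\<Sum>k<n*m. ennreal (mdist X (\<gamma> (s k)) (\<gamma> (s (Suc k)))))"
      by (simp add: sum_ennreal ennreal_leI)
  qed
qed

lemma curve_length_le_of_refinement:
  fixes Y Z :: "'a::metric_space metric"
  assumes "\<And>(n :: nat) (t :: nat \<Rightarrow> real). mono t \<Longrightarrow> range t \<subseteq> {a..b} \<Longrightarrow> \<exists>N s. mono s \<and> range s \<subseteq> {a..b} \<and>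
    (\<Sum>i<n. ennreal (mdist Y (\<gamma> (t i)) (\<gamma> (t (Suc i)))))
        \<le> (\<Sum>k<N. ennreal (mdist Z (\<gamma> (s k)) (\<gamma> (s (Suc k)))))"
  shows "curve_length Y \<gamma> a b \<le> curve_length Z \<gamma> a b"
  unfolding curve_length_def
proof (rule SUP_least)
  fix p assume "p \<in> {(n :: nat, t :: nat \<Rightarrow> real). mono t \<and> range t \<subseteq> {a..b}}"
  then obtain n :: nat and t :: "nat \<Rightarrow> real" where p: "p = (n, t)" "mono t" "range t \<subseteq> {a..b}" by auto
  obtain N :: nat and s :: "nat \<Rightarrow> real" where *: "mono s" "range s \<subseteq> {a..b}"
    "(\<Sum>i<n. ennreal (mdist Y (\<gamma> (t i)) (\<gamma> (t (Suc i)))))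
        \<le> (\<Sum>k<N. ennreal (mdist Z (\<gamma> (s k)) (\<gamma> (s (Suc k)))))"
    using assms[OF p(2,3)] by blast
  show "(case p of (n, t) \<Rightarrow> \<Sum>i<n. ennreal (mdist Y (\<gamma> (t i)) (\<gamma> (t (Suc i)))))
    \<le> (SUP (n, t) \<in> {(n :: nat, t :: nat \<Rightarrow> real). mono t \<and> range t \<subseteq> {a..b}}.
        \<Sum>i<n. ennreal (mdist Z (\<gamma> (t i)) (\<gamma> (t (Suc i)))))"
    by (rule SUP_upper2[of "(N, s)"]) (use * p in simp_all)
qed

text \<open>By uniform continuity a refined partition has jumps below \<open>\<epsilon>\<close>, where the two polygonal lengths
  coincide. Refining increases both of them, so the suprema agree.\<close>

lemma agree_below_curve_length:
  fixes X :: "'a::metric_space metric"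
  assumes "agree_below \<epsilon> X euclidean_metric" "\<epsilon> > 0" "continuous_on {a..b} \<gamma>"
  shows "curve_length X \<gamma> a b = curve_length euclidean_metric \<gamma> a b"
proof -
  have *: "curve_length Y \<gamma> a b \<le> curve_length Z \<gamma> a b"
    if Y: "mspace Y = UNIV" and YZ: "\<And>x y. dist x y < \<epsilon> \<Longrightarrow> mdist Y x y = mdist Z x y" for Y Z :: "'a metric"
  proof (rule curve_length_le_of_refinement)
    fix n :: nat and t :: "nat \<Rightarrow> real" assume t: "mono t" "range t \<subseteq> {a..b}"
    obtain N and s :: "nat \<Rightarrow> real" where s: "mono s" "range s \<subseteq> {a..b}" "\<forall>k. dist (\<gamma> (s k)) (\<gamma> (s (Suc k))) < \<epsilon>"
      and le: "\<forall>X :: 'a metric. mspace X = UNIV \<longrightarrow>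
        (\<Sum>i<n. ennreal (mdist X (\<gamma> (t i)) (\<gamma> (t (Suc i)))))
        \<le> (\<Sum>k<N. ennreal (mdist X (\<gamma> (s k)) (\<gamma> (s (Suc k)))))"
      using refine_partition[OF assms(3,2) t, of n] by (elim exE conjE)
    have "mdist Y (\<gamma> (s k)) (\<gamma> (s (Suc k))) = mdist Z (\<gamma> (s k)) (\<gamma> (s (Suc k)))" for k
      using s(3) YZ by blast
    then have "(\<Sum>i<n. ennreal (mdist Y (\<gamma> (t i)) (\<gamma> (t (Suc i)))))
        \<le> (\<Sum>k<N. ennreal (mdist Z (\<gamma> (s k)) (\<gamma> (s (Suc k)))))"
      using le[rule_format, OF Y] by simp
    then show "\<exists>N s. mono s \<and> range s \<subseteq> {a..b} \<and>
        (\<Sum>i<n. ennreal (mdist Y (\<gamma> (t i)) (\<gamma> (t (Suc i)))))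
        \<le> (\<Sum>k<N. ennreal (mdist Z (\<gamma> (s k)) (\<gamma> (s (Suc k)))))"
      using s(1,2) by (intro exI conjI)
  qed
  have X: "mspace X = UNIV" using agree_below_mspace[OF assms(1)] by simp
  have d: "mdist X x y = mdist euclidean_metric x y" if "dist x y < \<epsilon>" for x y
    using assms(1) that X unfolding agree_below_def mspace_euclidean_metric mdist_euclidean_metric
    by blast
  show ?thesis
    by (rule antisym) (rule *[OF X d], assumption, rule *[OF mspace_euclidean_metric d[symmetric]])
qed

text \<open>The arc length parametrization depends on the metric only through the length function, so
  equality of lengths is all that is needed.\<close>

lemma agree_below_line_integral:
  fixes X :: "'a::metric_space metric"
  assumes "agree_below \<epsilon> X euclidean_metric" "\<epsilon> > 0" "c \<in> curves X"
  shows "line_integral X \<rho> c = line_integral euclidean_metric \<rho> c"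
    and "locally_rectifiable X c \<longleftrightarrow> locally_rectifiable euclidean_metric c"
proof -
  obtain I \<gamma> where c: "c = (I, \<gamma>)" by fastforce
  have "continuous_on I \<gamma>"
    using assms(3) c agree_below_mtopology_of[OF assms(1,2)] unfolding curves_def by simp
  then have len: "curve_length X \<gamma> a t = curve_length euclidean_metric \<gamma> a t"
    if "{a..b} \<subseteq> I" "t \<le> b" for a b t
    using that by (intro agree_below_curve_length[OF assms(1,2)])
      (auto elim!: continuous_on_subset)
  show "locally_rectifiable X c \<longleftrightarrow> locally_rectifiable euclidean_metric c"
    unfolding locally_rectifiable_def c prod.case by (simp add: len[OF _ order_refl] cong: imp_cong)
  have arc: "arc_param X \<gamma> a b = arc_param euclidean_metric \<gamma> a b" if "{a..b} \<subseteq> I" for a b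
  proof
    fix s
    have "(\<lambda>t. t \<in> {a..b} \<and> curve_length X \<gamma> a t = ennreal s)
        = (\<lambda>t. t \<in> {a..b} \<and> curve_length euclidean_metric \<gamma> a t = ennreal s)"
      using len[OF that] by (intro ext) auto
    then show "arc_param X \<gamma> a b s = arc_param euclidean_metric \<gamma> a b s"
      unfolding arc_param_def by simp
  qed
  show "line_integral X \<rho> c = line_integral euclidean_metric \<rho> c"
    unfolding line_integral_def c prod.case
  proof (rule SUP_cong[OF refl], clarify)
    fix a b :: real assume ab: "a \<le> b" "{a..b} \<subseteq> I"
    show "(\<integral>\<^sup>+s\<in>{0..enn2real (curve_length X \<gamma> a b)}. \<rho> (arc_param X \<gamma> a b s) \<partial>lborel)
      = (\<integral>\<^sup>+s\<in>{0..enn2real (curve_length euclidean_metric \<gamma> a b)}.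
           \<rho> (arc_param euclidean_metric \<gamma> a b s) \<partial>lborel)"
      unfolding arc[OF ab(2)] len[OF ab(2) order_refl] ..
  qed
qed

lemma agree_below_conformal_modulus:
  fixes X :: "'a::metric_space metric"
  assumes "agree_below \<epsilon> X euclidean_metric" "\<epsilon> > 0" "\<Gamma> \<subseteq> curves X"
  shows "conformal_modulus X \<Gamma> = conformal_modulus euclidean_metric \<Gamma>"
proof -
  have "c \<in> curves X" if "c \<in> \<Gamma>" for c using assms(3) that by blast
  then have "admissible X \<Gamma> \<rho> \<longleftrightarrow> admissible euclidean_metric \<Gamma> \<rho>" for \<rho>
    unfolding admissible_def agree_below_hausdorff2_measure[OF assms(1,2)]
    by (simp add: agree_below_line_integral[OF assms(1,2)] cong: ball_cong)
  then have "admissible X \<Gamma> = admissible euclidean_metric \<Gamma>" by (rule ext)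
  then show ?thesis
    unfolding conformal_modulus_def agree_below_hausdorff2_measure[OF assms(1,2)] by (simp only:)
qed

lemma agree_below_quasiconformal_id:
  fixes X :: "'a::metric_space metric"
  assumes "agree_below \<epsilon> X euclidean_metric" "\<epsilon> > 0"
  shows "quasiconformal_homeo X euclidean_metric id"
proof -
  have id: "image_family id \<Gamma> = \<Gamma>" for \<Gamma> :: "'a curve set"
    unfolding image_family_def by (simp add: case_prod_eta)
  have "homeomorphic_map (mtopology_of X) (mtopology_of euclidean_metric) id"
    unfolding agree_below_mtopology_of[OF assms] by simp
  moreover have "ennreal (1 / 1) * conformal_modulus X \<Gamma> \<le> conformal_modulus euclidean_metric (image_family id \<Gamma>) \<and>
      conformal_modulus euclidean_metric (image_family id \<Gamma>) \<le> ennreal 1 * conformal_modulus X \<Gamma>"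
    if "\<Gamma> \<subseteq> curves X" for \<Gamma>
    unfolding id agree_below_conformal_modulus[OF assms that] by simp
  ultimately show ?thesis
    unfolding quasiconformal_homeo_def by (intro conjI exI[of _ "1::real"] allI impI order_refl) simp_all
qed

section \<open>Hausdorff measure of planar squares\<close>

lemma hausdorff2_mono: "A \<subseteq> B \<Longrightarrow> hausdorff2 X A \<le> hausdorff2 X B"
  unfolding hausdorff2_def hausdorff2_content_def
  by (intro SUP_mono' INF_superset_mono) auto

definition square :: "real \<Rightarrow> real \<Rightarrow> real \<Rightarrow> (real^2) set" where
  "square a b h = {p. a \<le> p$1 \<and> p$1 \<le> a + h \<and> b \<le> p$2 \<and> p$2 \<le> b + h}"

definition rectangle :: "real \<Rightarrow> real \<Rightarrow> real \<Rightarrow> real \<Rightarrow> (real^2) set" where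
  "rectangle a b w h = {p. a \<le> p$1 \<and> p$1 < a + w \<and> b \<le> p$2 \<and> p$2 < b + h}"

lemma dist_plane_le: "dist x (y :: real^2) \<le> \<bar>x$1 - y$1\<bar> + \<bar>x$2 - y$2\<bar>"
  using norm_le_l1_cart[of "x - y"] by (simp add: dist_norm sum_2)

lemma component_diff_le_dist: "\<bar>x$i - y$i\<bar> \<le> dist x (y :: real^2)"
  using component_le_norm_cart[of "x - y" i] by (simp add: dist_norm)

lemma square_eq_cbox: "square a b h = cbox (vector [a, b]) (vector [a + h, b + h])"
  unfolding square_def by (auto simp: mem_box_cart forall_2)

lemma emeasure_square:
  assumes "h \<ge> 0"
  shows "emeasure lborel (square a b h) = ennreal (h\<^sup>2)"
proof -
  let ?l = "vector [a, b] :: real^2" and ?u = "vector [a + h, b + h] :: real^2"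
  have "?l \<in> cbox ?l ?u" using assms by (simp add: mem_box_cart forall_2)
  then have "measure lborel (cbox ?l ?u) = h\<^sup>2"
    by (subst content_cbox_cart) (auto simp: UNIV_2 power2_eq_square)
  then show ?thesis
    unfolding square_eq_cbox using emeasure_lborel_cbox_finite[of ?l ?u]
    by (simp add: emeasure_eq_ennreal_measure)
qed

lemma mdiam_square_le: "mdiam plane (square a b h) \<le> ennreal (2 * h)"
  unfolding mdiam_def
proof (intro SUP_least ennreal_leI)
  fix x y assume "x \<in> square a b h" "y \<in> square a b h"
  then have "\<bar>x$1 - y$1\<bar> \<le> h" "\<bar>x$2 - y$2\<bar> \<le> h" unfolding square_def by auto
  then show "mdist plane x y \<le> 2 * h" using dist_plane_le[of x y] by simp
qed

text \<open>A set of diameter \<open>d\<close> lies in the square of side \<open>2 * d\<close> centred at any of its points. This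
  crude bound replaces the isodiametric inequality: only comparability of Hausdorff and Lebesgue
  measure matters here.\<close>

lemma subset_square_of_mdiam:
  assumes "mdiam plane E < \<infinity>"
  shows "\<exists>S \<in> sets borel. E \<subseteq> S \<and> emeasure lborel S \<le> 16 * (ennreal (pi / 4) * (mdiam plane E)\<^sup>2)"
proof (cases "E = {}")
  case False
  then obtain x where x: "x \<in> E" by blast
  obtain d where d: "d \<ge> 0" "mdiam plane E = ennreal d"
    using assms by (cases "mdiam plane E") auto
  have "E \<subseteq> square (x$1 - d) (x$2 - d) (2 * d)"
  proof
    fix y assume "y \<in> E"
    then have "ennreal (dist x y) \<le> mdiam plane E"
      unfolding mdiam_def using x by (intro SUP_upper2[of x] SUP_upper2[of y]) auto
    then have "dist x y \<le> d" using d by simp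
    then show "y \<in> square (x$1 - d) (x$2 - d) (2 * d)"
      using component_diff_le_dist[of x 1 y] component_diff_le_dist[of x 2 y]
      unfolding square_def by (simp add: abs_le_iff)
  qed
  moreover have "emeasure lborel (square (x$1 - d) (x$2 - d) (2 * d))
      \<le> 16 * (ennreal (pi / 4) * (mdiam plane E)\<^sup>2)"
  proof -
    have "1 * d\<^sup>2 \<le> pi * d\<^sup>2"
      using pi_gt3 by (intro mult_right_mono) auto
    then have "ennreal ((2 * d)\<^sup>2) \<le> ennreal (16 * (pi / 4 * d\<^sup>2))"
      by (intro ennreal_leI) (simp add: power_mult_distrib)
    also have "\<dots> = 16 * (ennreal (pi / 4) * (mdiam plane E)\<^sup>2)"
      unfolding d(2) ennreal_power[OF d(1)]
      by (subst ennreal_mult, simp, simp, subst ennreal_mult) simp_all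
    finally show ?thesis using d(1) by (simp add: emeasure_square)
  qed
  moreover have "square (x$1 - d) (x$2 - d) (2 * d) \<in> sets borel"
    unfolding square_eq_cbox by simp
  ultimately show ?thesis by blast
qed (auto intro!: bexI[of _ "{}"])

text \<open>Every countable cover has total Lebesgue measure at least that of the square, and each member
  contributes a multiple of its Lebesgue measure.\<close>

lemma hausdorff2_square_ge:
  assumes "h \<ge> 0"
  shows "ennreal (h\<^sup>2 / 16) \<le> hausdorff2 plane (square a b h)"
proof -
  have "ennreal (h\<^sup>2 / 16) \<le> hausdorff2_content plane 1 (square a b h)"
    unfolding hausdorff2_content_def
  proof (rule INF_greatest)
    fix E :: "nat \<Rightarrow> (real^2) set"
    assume "E \<in> {E. square a b h \<subseteq> (\<Union>i. E i) \<and> (\<forall>i. E i \<subseteq> mspace plane \<and> mdiam plane (E i) \<le> ennreal 1)}"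
    then have E: "square a b h \<subseteq> (\<Union>i. E i)" "\<And>i. mdiam plane (E i) \<le> ennreal 1" by auto
    let ?t = "\<lambda>i. ennreal (pi / 4) * (mdiam plane (E i))\<^sup>2"
    have "mdiam plane (E i) < \<infinity>" for i
      using E(2)[of i] by (rule order_le_less_trans) simp
    then have "\<forall>i. \<exists>S \<in> sets borel. E i \<subseteq> S \<and> emeasure lborel S \<le> 16 * ?t i"
      using subset_square_of_mdiam by blast
    then obtain S where S: "\<And>i. S i \<in> sets borel" "\<And>i. E i \<subseteq> S i" "\<And>i. emeasure lborel (S i) \<le> 16 * ?t i"
      by metis
    have "16 * ennreal (h\<^sup>2 / 16) = ennreal (h\<^sup>2)"
      by (simp add: ennreal_mult'[symmetric] ennreal_numeral[symmetric] del: ennreal_numeral)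
    also have "\<dots> = emeasure lborel (square a b h)" using assms by (simp add: emeasure_square)
    also have "\<dots> \<le> emeasure lborel (\<Union>i. S i)"
      using E(1) S by (intro emeasure_mono) (auto, blast)
    also have "\<dots> \<le> (\<Sum>i. emeasure lborel (S i))"
      using S(1) by (intro emeasure_subadditive_countably) auto
    also have "\<dots> \<le> (\<Sum>i. 16 * ?t i)" using S(3) by (intro suminf_le) auto
    also have "\<dots> = 16 * (\<Sum>i. ?t i)" by (rule ennreal_suminf_cmult)
    finally show "ennreal (h\<^sup>2 / 16) \<le> (\<Sum>i. ?t i)"
      by (subst (asm) ennreal_mult_le_mult_iff) auto
  qed
  also have "\<dots> \<le> hausdorff2 plane (square a b h)"
    unfolding hausdorff2_def by (rule SUP_upper) simp
  finally show ?thesis .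
qed

text \<open>Covers by equal squares suffice as upper bounds: such a square of side \<open>h\<close> has diameter at
  most \<open>2 * h\<close>, hence contributes at most \<open>pi * h\<^sup>2\<close>.\<close>

lemma hausdorff2_le_of_squares:
  assumes "\<And>\<delta>. \<delta> > 0 \<Longrightarrow> \<exists>h P. 0 \<le> h \<and> 2 * h \<le> \<delta> \<and> finite P \<and> A \<subseteq> (\<Union>(a, b)\<in>P. square a b h)
    \<and> real (card P) * h\<^sup>2 \<le> c"
  shows "hausdorff2 plane A \<le> ennreal (pi * c)"
  unfolding hausdorff2_def
proof (rule SUP_least)
  fix \<delta> :: real assume "\<delta> \<in> {0<..}"
  then obtain h P where h: "0 \<le> h" "2 * h \<le> \<delta>" and P: "finite P" "A \<subseteq> (\<Union>(a, b)\<in>P. square a b h)"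
    and c: "real (card P) * h\<^sup>2 \<le> c"
    using assms by (metis greaterThan_iff)
  obtain f where f: "bij_betw f {0..<card P} P" using ex_bij_betw_nat_finite[OF P(1)] by blast
  define E where "E i = (if i < card P then case f i of (a, b) \<Rightarrow> square a b h else {})" for i
  have diam: "mdiam plane (E i) \<le> ennreal (2 * h)" for i
    unfolding E_def using mdiam_square_le by (auto simp: mdiam_def[of _ "{}"] split: prod.split)
  have "A \<subseteq> (\<Union>i. E i)"
  proof
    fix x assume "x \<in> A"
    then obtain q where q: "q \<in> P" "x \<in> (case q of (a, b) \<Rightarrow> square a b h)" using P(2) by blast
    moreover have "q \<in> f ` {0..<card P}" using q(1) bij_betw_imp_surj_on[OF f] by simp
    then obtain i where "i < card P" "f i = q" by auto
    ultimately show "x \<in> (\<Union>i. E i)" by (intro UN_I[of i]) (auto simp: E_def)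
  qed
  moreover have "mdiam plane (E i) \<le> ennreal \<delta>" for i
    using diam[of i] ennreal_leI[OF h(2)] by order
  ultimately have "hausdorff2_content plane \<delta> A \<le> (\<Sum>i. ennreal (pi / 4) * (mdiam plane (E i))\<^sup>2)"
    unfolding hausdorff2_content_def by (intro INF_lower) simp
  also have "\<dots> = (\<Sum>i<card P. ennreal (pi / 4) * (mdiam plane (E i))\<^sup>2)"
    by (rule suminf_finite) (auto simp: E_def mdiam_def bot_ennreal)
  also have "\<dots> \<le> (\<Sum>i<card P. ennreal (pi * h\<^sup>2))"
  proof (rule sum_mono)
    fix i
    have "ennreal (pi / 4) * (mdiam plane (E i))\<^sup>2 \<le> ennreal (pi / 4) * (ennreal (2 * h))\<^sup>2"
      by (intro mult_left_mono power_mono diam) auto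
    also have "\<dots> = ennreal (pi * h\<^sup>2)"
      using h(1) by (simp add: ennreal_power ennreal_mult'[symmetric] power_mult_distrib del: ennreal_mult'')
    finally show "ennreal (pi / 4) * (mdiam plane (E i))\<^sup>2 \<le> ennreal (pi * h\<^sup>2)" .
  qed
  also have "\<dots> = ennreal (pi * (real (card P) * h\<^sup>2))"
    by (simp add: ennreal_of_nat_eq_real_of_nat ennreal_mult'[symmetric] mult.left_commute)
  also have "\<dots> \<le> ennreal (pi * c)"
    using c by (intro ennreal_leI mult_left_mono) auto
  finally show "hausdorff2_content plane \<delta> A \<le> ennreal (pi * c)" .
qed

lemma rectangle_grid:
  assumes "h > 0"
  obtains P where "finite P" "card P \<le> m * n"
    "rectangle a b (real m * h) (real n * h) \<subseteq> (\<Union>(a, b)\<in>P. square a b h)"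
proof
  let ?g = "\<lambda>(i, j). (a + real i * h, b + real j * h)"
  let ?P = "?g ` ({..<m} \<times> {..<n})"
  show "finite ?P" by simp
  show "card ?P \<le> m * n"
    using card_image_le[of "{..<m} \<times> {..<n}" ?g] by simp
  show "rectangle a b (real m * h) (real n * h) \<subseteq> (\<Union>(a, b)\<in>?P. square a b h)"
  proof
    fix p assume p: "p \<in> rectangle a b (real m * h) (real n * h)"
    have *: "\<exists>i<k. c + real i * h \<le> x \<and> x \<le> c + real i * h + h"
      if "c \<le> x" "x < c + real k * h" for c x k
    proof (intro exI conjI)
      define i where "i = nat \<lfloor>(x - c) / h\<rfloor>"
      have "0 \<le> (x - c) / h" using that \<open>h > 0\<close> by simp
      then have i: "real i \<le> (x - c) / h" "(x - c) / h < real i + 1"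
        unfolding i_def by linarith+
      then show "c + real i * h \<le> x" "x \<le> c + real i * h + h"
        using \<open>h > 0\<close> by (simp_all add: field_simps)
      have "(x - c) / h < real k" using that \<open>h > 0\<close> by (simp add: field_simps)
      then show "i < k" using i by linarith
    qed
    obtain i j where "i < m" "j < n" "p \<in> square (a + real i * h) (b + real j * h) h"
      using *[of a "p$1" m] *[of b "p$2" n] p unfolding rectangle_def square_def by blast
    then show "p \<in> (\<Union>(a, b)\<in>?P. square a b h)" by force
  qed
qed

text \<open>Two rectangles are needed because a ball of the folded plane may have a part on either side of
  the fold. They are commensurable with a common square of side \<open>s\<close>, which can be subdivided to
  serve every scale.\<close>

lemma hausdorff2_two_rectangles_le:
  assumes "s > 0"
    and A: "A \<subseteq> rectangle a b (real m * s) (real n * s) \<union> rectangle a' b' (real m * s) (real n * s)"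
  shows "hausdorff2 plane A \<le> ennreal (pi * (2 * real m * real n * s\<^sup>2))"
proof (rule hausdorff2_le_of_squares)
  fix \<delta> :: real assume "\<delta> > 0"
  obtain k :: nat where k: "2 * s / \<delta> < real k" using reals_Archimedean2 by blast
  then have "k > 0" using \<open>s > 0\<close> \<open>\<delta> > 0\<close> by (auto intro!: Nat.gr0I simp: divide_less_0_iff)
  define h where "h = s / real k"
  have "h > 0" using \<open>s > 0\<close> \<open>k > 0\<close> by (simp add: h_def)
  have ks: "real (i * k) * h = real i * s" for i using \<open>k > 0\<close> by (simp add: h_def)
  obtain P where P: "finite P" "card P \<le> (m * k) * (n * k)"
    "rectangle a b (real m * s) (real n * s) \<subseteq> (\<Union>(a, b)\<in>P. square a b h)"
    by (rule rectangle_grid[OF \<open>h > 0\<close>, of "m * k" "n * k" a b]) (simp only: ks)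
  obtain Q where Q: "finite Q" "card Q \<le> (m * k) * (n * k)"
    "rectangle a' b' (real m * s) (real n * s) \<subseteq> (\<Union>(a, b)\<in>Q. square a b h)"
    by (rule rectangle_grid[OF \<open>h > 0\<close>, of "m * k" "n * k" a' b']) (simp only: ks)
  have "real (card (P \<union> Q)) \<le> real (2 * ((m * k) * (n * k)))"
    using card_Un_le[of P Q] P(2) Q(2) by (intro of_nat_mono) linarith
  then have "real (card (P \<union> Q)) * h\<^sup>2 \<le> real (2 * ((m * k) * (n * k))) * h\<^sup>2"
    by (rule mult_right_mono) simp
  also have "\<dots> = 2 * (real (m * k) * h) * (real (n * k) * h)" by (simp add: power2_eq_square)
  also have "\<dots> = 2 * real m * real n * s\<^sup>2" unfolding ks by (simp add: power2_eq_square)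
  finally have "real (card (P \<union> Q)) * h\<^sup>2 \<le> 2 * real m * real n * s\<^sup>2" .
  moreover have "2 * h \<le> \<delta>" using k \<open>k > 0\<close> \<open>\<delta> > 0\<close> by (simp add: h_def field_simps)
  moreover have "A \<subseteq> (\<Union>(a, b)\<in>P \<union> Q. square a b h)" using A P(3) Q(3) by blast
  ultimately show "\<exists>h P. 0 \<le> h \<and> 2 * h \<le> \<delta> \<and> finite P \<and> A \<subseteq> (\<Union>(a, b)\<in>P. square a b h)
      \<and> real (card P) * h\<^sup>2 \<le> 2 * real m * real n * s\<^sup>2"
    using P(1) Q(1) \<open>h > 0\<close> by (intro exI[of _ h] exI[of _ "P \<union> Q"]) simp
qed

section \<open>The folded plane\<close>

definition mirror :: "real^2 \<Rightarrow> real^2" where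
  "mirror x = vector [- x$1, x$2]"

lemma mirror_nth [simp]: "mirror x $ 1 = - x$1" "mirror x $ 2 = x$2"
  unfolding mirror_def by simp_all

lemma mirror_mirror [simp]: "mirror (mirror x) = x"
  by (simp add: vec_eq_iff forall_2)

lemma dist_mirror [simp]: "dist (mirror x) (mirror y) = dist x y"
proof -
  have "dist (mirror x $ 1) (mirror y $ 1) = dist (x $ 1) (y $ 1)"
    by (simp add: dist_real_def)
  then show ?thesis unfolding dist_vec_def L2_set_def sum_2 by simp
qed

lemma dist_mirror_swap: "dist (mirror x) y = dist x (mirror y)"
  using dist_mirror[of x "mirror y"] by simp

text \<open>The second term is the length of a jump across the fold, which costs 1.\<close>

definition fold_dist :: "real^2 \<Rightarrow> real^2 \<Rightarrow> real" where
  "fold_dist x y = min (dist x y) (1 + dist x (mirror y))"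

text \<open>Two successive jumps across the fold cancel, since the reflection is an involutive isometry;
  this gives the triangle inequality.\<close>

interpretation fold_metric: Metric_space UNIV fold_dist
proof
  fix x y z :: "real^2"
  show "0 \<le> fold_dist x y" unfolding fold_dist_def by simp
  show "fold_dist x y = fold_dist y x"
    unfolding fold_dist_def using dist_mirror_swap[of x y] by (simp add: dist_commute)
  show "fold_dist x y = 0 \<longleftrightarrow> x = y"
  proof -
    have "1 + dist x (mirror y) \<noteq> 0" using zero_le_dist[of x "mirror y"] by linarith
    moreover have "0 \<le> 1 + dist x (mirror y)" by simp
    ultimately show ?thesis unfolding fold_dist_def min_def by auto
  qed
  have "dist x z \<le> dist x y + dist y z" "dist x (mirror z) \<le> dist x y + dist y (mirror z)"
    "dist x z \<le> dist x (mirror y) + dist (mirror y) z"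
    "dist x (mirror z) \<le> dist x (mirror y) + dist (mirror y) (mirror z)"
    by (rule dist_triangle)+
  then show "fold_dist x z \<le> fold_dist x y + fold_dist y z"
    unfolding fold_dist_def using dist_mirror_swap[of y z] dist_mirror[of y z] by linarith
qed

definition folded_plane :: "(real^2) metric" where
  "folded_plane = metric (UNIV, fold_dist)"

lemma mspace_folded_plane [simp]: "mspace folded_plane = UNIV"
  and mdist_folded_plane [simp]: "mdist folded_plane = fold_dist"
  unfolding folded_plane_def by simp_all

lemma folded_plane_agrees: "agree_below 1 folded_plane plane"
proof -
  have "fold_dist x y = dist x y" if "fold_dist x y < 1 \<or> dist x y < 1" for x y
    using that zero_le_dist[of x "mirror y"] unfolding fold_dist_def by linarith
  then show ?thesis unfolding agree_below_def by simp
qed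

lemmas mtopology_of_folded_plane = agree_below_mtopology_of[OF folded_plane_agrees zero_less_one]
lemmas hausdorff2_folded_plane = agree_below_hausdorff2[OF folded_plane_agrees zero_less_one]

text \<open>The factor 3 leaves room for the estimate of the Euclidean by the \<open>l\<^sup>1\<close> distance, here
  and below.\<close>

lemma square_subset_fold_ball: "square (x$1) (x$2) (R / 3) \<subseteq> mball_of folded_plane x R" if "R > 0"
proof
  fix y assume "y \<in> square (x$1) (x$2) (R / 3)"
  then have "dist x y < R" using dist_plane_le[of x y] that unfolding square_def by auto
  then show "y \<in> mball_of folded_plane x R" by (simp add: fold_dist_def)
qed

lemma ahlfors_2_regular_folded_plane: "ahlfors_2_regular folded_plane"
  unfolding ahlfors_2_regular_def
  \<comment> \<open>The constant comes from the squares of side \<open>R / 3\<close>, as \<open>(R / 3)\<^sup>2 / 16 = R\<^sup>2 / 144\<close>.\<close>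
proof (intro exI[of _ 144] conjI ballI allI impI)
  fix x :: "real^2" and R :: real assume "0 < R \<and> ennreal R < mdiam folded_plane (mspace folded_plane)"
  then have R: "R > 0" by simp
  have "ennreal ((R / 3)\<^sup>2 / 16) \<le> hausdorff2 plane (square (x$1) (x$2) (R / 3))"
    by (rule hausdorff2_square_ge) (use R in simp)
  also have "\<dots> \<le> hausdorff2 plane (mball_of folded_plane x R)"
    by (intro hausdorff2_mono square_subset_fold_ball R)
  finally show "ennreal (R\<^sup>2 / 144) \<le> hausdorff2 folded_plane (mball_of folded_plane x R)"
    by (simp add: hausdorff2_folded_plane power_divide)
  have "mball_of folded_plane x R \<subseteq> rectangle (x$1 - R) (x$2 - R) (real 1 * (2 * R)) (real 1 * (2 * R))
      \<union> rectangle (- x$1 - R) (x$2 - R) (real 1 * (2 * R)) (real 1 * (2 * R))"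
  proof
    fix y assume "y \<in> mball_of folded_plane x R"
    then consider "dist x y < R" | "dist x (mirror y) < R" by (auto simp: fold_dist_def min_less_iff_disj)
    then show "y \<in> rectangle (x$1 - R) (x$2 - R) (real 1 * (2 * R)) (real 1 * (2 * R))
      \<union> rectangle (- x$1 - R) (x$2 - R) (real 1 * (2 * R)) (real 1 * (2 * R))"
    proof cases
      case 1
      then show ?thesis using component_diff_le_dist[of x 1 y] component_diff_le_dist[of x 2 y]
        unfolding rectangle_def by (simp add: abs_le_iff)
    next
      case 2
      then show ?thesis
        using component_diff_le_dist[of x 1 "mirror y"] component_diff_le_dist[of x 2 "mirror y"]
        unfolding rectangle_def by (simp add: abs_le_iff)
    qed
  qed
  then have "hausdorff2 plane (mball_of folded_plane x R) \<le> ennreal (pi * (2 * real 1 * real 1 * (2 * R)\<^sup>2))"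
    by (rule hausdorff2_two_rectangles_le[rotated]) (use R in simp)
  also have "\<dots> \<le> ennreal (144 * R\<^sup>2)"
  proof (rule ennreal_leI)
    have "8 * pi * R\<^sup>2 \<le> 144 * R\<^sup>2" using pi_less_4 by (intro mult_right_mono) auto
    then show "pi * (2 * real 1 * real 1 * (2 * R)\<^sup>2) \<le> 144 * R\<^sup>2" by (simp add: power_mult_distrib)
  qed
  finally show "hausdorff2 folded_plane (mball_of folded_plane x R) \<le> ennreal (144 * R\<^sup>2)"
    by (simp add: hausdorff2_folded_plane)
qed simp

section \<open>A half-plane with long teeth\<close>

definition left_half :: "(real^2) set" where
  "left_half = {p. p$1 \<le> 0}"

definition tooth :: "nat \<Rightarrow> (real^2) set" where
  "tooth n = {p. p$1 \<le> real n \<and> \<bar>p$2 - (real n)\<^sup>2\<bar> \<le> 1}"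

definition comb :: "(real^2) set" where
  "comb = left_half \<union> (\<Union>n. tooth n)"

text \<open>Consequently only finitely many teeth lie below a given height, which makes the comb closed and
  lets its complement be connected to the right of them.\<close>

lemma tooth_height: "p \<in> tooth n \<Longrightarrow> real n \<le> p$2 + 1"
proof -
  assume "p \<in> tooth n"
  then have "(real n)\<^sup>2 \<le> p$2 + 1" unfolding tooth_def by (simp add: abs_le_iff)
  moreover have "real n \<le> (real n)\<^sup>2" by (cases n) (auto simp: power2_eq_square)
  ultimately show ?thesis by linarith
qed

lemma closed_left_half: "closed left_half" and closed_tooth: "closed (tooth n)"
  unfolding left_half_def tooth_def
  by (intro closed_Collect_conj closed_Collect_le continuous_intros)+

lemma connected_left_half: "connected left_half" and connected_tooth: "connected (tooth n)"
  unfolding left_half_def tooth_def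
  by (rule is_interval_connected, unfold is_interval_cart forall_2, auto)+

lemma connected_comb: "connected comb"
  unfolding comb_def
proof (rule connected_Un_UN)
  fix T assume "T \<in> range tooth"
  then obtain n where T: "T = tooth n" by blast
  then show "connected T" by (simp add: connected_tooth)
  have "vector [0, (real n)\<^sup>2] \<in> left_half \<inter> tooth n" unfolding left_half_def tooth_def by simp
  then show "left_half \<inter> T \<noteq> {}" using T by blast
qed (rule connected_left_half)

lemma open_complement_comb: "open (- comb)"
proof (rule Topological_Spaces.openI)
  fix p assume p: "p \<in> - comb"
  obtain K :: nat where K: "p$2 + 1 < real K" using reals_Archimedean2 by blast
  let ?U = "{z. z$2 + 1 < real K} \<inter> - left_half \<inter> (\<Inter>n\<in>{..<K}. - tooth n)"
  have "open ?U"
    by (intro open_Int open_INT ballI) (auto simp: open_Compl closed_left_half closed_tooth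
        intro!: open_Collect_less continuous_intros)
  moreover have "p \<in> ?U" using p K unfolding comb_def by auto
  moreover have "?U \<subseteq> - comb"
  proof
    fix z assume z: "z \<in> ?U"
    have "z \<notin> tooth n" for n
    proof
      assume n: "z \<in> tooth n"
      then have "real n < real K" using tooth_height[OF n] z by simp
      then show False using z n by auto
    qed
    then show "z \<in> - comb" using z unfolding comb_def by auto
  qed
  ultimately show "\<exists>T. open T \<and> p \<in> T \<and> T \<subseteq> - comb" by blast
qed

text \<open>From any point outside the comb the horizontal ray to the right avoids the comb, and below a
  given height all such rays enter the convex region \<open>V\<close> to the right of the finitely many teeth
  there.\<close>

lemma connected_complement_comb: "connected (- comb)"
  unfolding connected_iff_connected_component
proof (intro ballI)
  fix p q assume pq: "p \<in> - comb" "q \<in> - comb"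
  obtain K :: nat where K: "p$2 < real K" "q$2 < real K"
    using reals_Archimedean2[of "max (p$2) (q$2)"] by auto
  define ray :: "real^2 \<Rightarrow> (real^2) set" where "ray u = {z. u$1 \<le> z$1 \<and> z$2 = u$2}" for u
  define V :: "(real^2) set" where "V = {z. real K + 1 < z$1 \<and> z$2 < real K}"
  have ray: "connected (ray u)" for u
    unfolding ray_def by (rule is_interval_connected, unfold is_interval_cart forall_2, auto)
  have V: "connected V"
    unfolding V_def by (rule is_interval_connected, unfold is_interval_cart forall_2, auto)
  have meet: "ray u \<inter> V \<noteq> {}" if "u$2 < real K" for u
  proof -
    have "vector [max (u$1) (real K + 2), u$2] \<in> ray u \<inter> V"
      using that unfolding ray_def V_def by simp
    then show ?thesis by blast
  qed
  have "V \<subseteq> - comb"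
  proof
    fix z assume z: "z \<in> V"
    have "z \<notin> tooth n" for n
      using z tooth_height[of z n] unfolding V_def tooth_def by auto
    then show "z \<in> - comb" using z unfolding comb_def V_def left_half_def by auto
  qed
  moreover have "ray u \<subseteq> - comb" if "u \<in> - comb" for u
    using that unfolding ray_def comb_def left_half_def tooth_def by fastforce
  ultimately have sub: "V \<union> \<Union>{ray p, ray q} \<subseteq> - comb" using pq by blast
  have "connected (V \<union> \<Union>{ray p, ray q})"
    by (rule connected_Un_UN) (use V ray meet K in auto)
  moreover have "p \<in> ray p" "q \<in> ray q" unfolding ray_def by auto
  ultimately show "connected_component (- comb) p q"
    unfolding connected_component_def using sub by (intro exI[of _ "V \<union> \<Union>{ray p, ray q}"]) auto
qed

text \<open>The square extends to the left, where every tooth and the half-plane continue; inside a tooth it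
  also extends towards the axis of the tooth, whose half-height 1 bounds the possible sizes.\<close>

lemma comb_contains_square:
  assumes "p \<in> comb" "0 \<le> s" "s \<le> 1 \<or> p$1 \<le> 0"
  obtains b where "square (p$1 - s) b s \<subseteq> comb" "b \<le> p$2" "p$2 \<le> b + s"
proof (cases "p$1 \<le> 0")
  case True
  have "square (p$1 - s) (p$2) s \<subseteq> comb"
    using True unfolding square_def comb_def left_half_def by auto
  then show ?thesis using assms(2) by (intro that[of "p$2"]) auto
next
  case False
  then obtain n where n: "p \<in> tooth n" and s: "s \<le> 1" using assms unfolding comb_def left_half_def by auto
  define b where "b = (if p$2 \<le> (real n)\<^sup>2 then p$2 else p$2 - s)"
  have "square (p$1 - s) b s \<subseteq> tooth n"
    using n s assms(2) unfolding square_def tooth_def b_def by (auto simp: abs_le_iff)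
  then show ?thesis using assms(2) by (intro that[of b]) (auto simp: b_def comb_def)
qed

text \<open>Balls of radius at most 3 see a square of the comb at their centre. A larger ball around a point
  of the right half-plane still has radius at least two thirds of the original after a jump across the
  fold, and then contains a square of the left half-plane.\<close>

lemma fat_comb_folded_plane: "fat folded_plane (1 / 144) comb"
  unfolding fat_def
proof (intro ballI allI impI)
  fix x r assume x: "x \<in> comb" and r: "(0::real) < r"
  have "\<exists>a b. square a b (r / 3) \<subseteq> comb \<inter> mball_of folded_plane x r"
  proof (cases "r \<le> 3 \<or> x$1 \<le> 0")
    case True
    then have "r / 3 \<le> 1 \<or> x$1 \<le> 0" by auto
    with x r obtain b where b: "square (x$1 - r / 3) b (r / 3) \<subseteq> comb" "b \<le> x$2" "x$2 \<le> b + r / 3"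
      using comb_contains_square[of x "r / 3"] by auto
    have "square (x$1 - r / 3) b (r / 3) \<subseteq> mball_of folded_plane x r"
    proof
      fix y assume "y \<in> square (x$1 - r / 3) b (r / 3)"
      then have "\<bar>x$1 - y$1\<bar> \<le> r / 3" "\<bar>x$2 - y$2\<bar> \<le> r / 3" using b(2,3) unfolding square_def mem_Collect_eq by linarith+
      then have "dist x y < r" using dist_plane_le[of x y] r by simp
      then show "y \<in> mball_of folded_plane x r" by (simp add: fold_dist_def)
    qed
    then show ?thesis using b by blast
  next
    case False
    have "square (- x$1 - r / 3) (x$2) (r / 3) \<subseteq> comb \<inter> mball_of folded_plane x r"
    proof
      fix y assume y: "y \<in> square (- x$1 - r / 3) (x$2) (r / 3)"
      then have "\<bar>x$1 - mirror y$1\<bar> \<le> r / 3" "\<bar>x$2 - mirror y$2\<bar> \<le> r / 3"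
        unfolding square_def by auto
      \<comment> \<open>The distance is at most \<open>2 * r / 3\<close>, and \<open>r > 3\<close> pays for the jump.\<close>
      then have "1 + dist x (mirror y) < r" using dist_plane_le[of x "mirror y"] False by simp
      moreover have "y \<in> comb" using y False unfolding square_def comb_def left_half_def by auto
      ultimately show "y \<in> comb \<inter> mball_of folded_plane x r" by (simp add: fold_dist_def)
    qed
    then show ?thesis by blast
  qed
  then obtain a b where ab: "square a b (r / 3) \<subseteq> comb \<inter> mball_of folded_plane x r" by blast
  have "ennreal (1 / 144 * r\<^sup>2) = ennreal ((r / 3)\<^sup>2 / 16)" by (simp add: power_divide)
  also have "\<dots> \<le> hausdorff2 plane (square a b (r / 3))"
    by (rule hausdorff2_square_ge) (use r in simp)
  also have "\<dots> \<le> hausdorff2 folded_plane (comb \<inter> mball_of folded_plane x r)"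
    unfolding hausdorff2_folded_plane by (rule hausdorff2_mono[OF ab])
  finally show "ennreal (1 / 144 * r\<^sup>2) \<le> hausdorff2 folded_plane (comb \<inter> mball_of folded_plane x r)" .
qed

text \<open>The choice of quadratic heights makes the gaps grow, so that the discs of radius \<open>n\<close> around the
  tip of the \<open>n\<close>-th tooth miss all other teeth.\<close>

lemma teeth_apart:
  assumes "m \<noteq> n" "2 \<le> n"
  shows "real n + 1 \<le> \<bar>(real m)\<^sup>2 - (real n)\<^sup>2\<bar>"
proof (cases "m < n")
  case True
  then have "real m \<le> real n - 1" by linarith
  then have "(real m)\<^sup>2 \<le> (real n - 1)\<^sup>2" by (intro power_mono) auto
  then show ?thesis using assms(2) by (simp add: power2_eq_square algebra_simps)
next
  case False
  then have "real n + 1 \<le> real m" using assms(1) by simp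
  then have "(real n + 1)\<^sup>2 \<le> (real m)\<^sup>2" by (intro power_mono) auto
  then show ?thesis by (simp add: power2_eq_square algebra_simps)
qed

lemma comb_near_tip:
  assumes "2 \<le> n"
  shows "comb \<inter> mball_of plane (vector [real n, (real n)\<^sup>2]) (real n)
    \<subseteq> rectangle 0 ((real n)\<^sup>2 - 1) (2 * real n) 3"
proof
  fix p assume p: "p \<in> comb \<inter> mball_of plane (vector [real n, (real n)\<^sup>2]) (real n)"
  then have d: "\<bar>real n - p$1\<bar> < real n" "\<bar>(real n)\<^sup>2 - p$2\<bar> < real n"
    using component_diff_le_dist[of "vector [real n, (real n)\<^sup>2]" 1 p]
      component_diff_le_dist[of "vector [real n, (real n)\<^sup>2]" 2 p] by auto
  then have "p \<notin> left_half" unfolding left_half_def by auto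
  then obtain m where "p \<in> tooth m" using p unfolding comb_def by auto
  then have m: "\<bar>p$2 - (real m)\<^sup>2\<bar> \<le> 1" "p$1 \<le> real m" unfolding tooth_def by auto
  have mn: "m = n"
  proof (rule ccontr)
    assume "m \<noteq> n"
    from teeth_apart[OF this assms] show False using m(1) d(2) by linarith
  qed
  show "p \<in> rectangle 0 ((real n)\<^sup>2 - 1) (2 * real n) 3"
    using d(1) m[unfolded mn] unfolding rectangle_def mem_Collect_eq by (intro conjI; linarith)
qed

text \<open>The bound \<open>12 * pi * n\<close> for the measure near a tip is linear in \<open>n\<close>, while fatness asks for
  \<open>\<tau> * n\<^sup>2\<close>.\<close>

lemma not_fat_comb_plane:
  assumes "\<tau> > 0"
  shows "\<not> fat plane \<tau> comb"
proof
  assume fat: "fat plane \<tau> comb"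
  obtain n :: nat where n: "max 2 (12 * pi / \<tau>) < real n" using reals_Archimedean2 by blast
  define tip :: "real^2" where "tip = vector [real n, (real n)\<^sup>2]"
  have "tip \<in> tooth n" unfolding tip_def tooth_def by simp
  then have "tip \<in> comb" unfolding comb_def by blast
  moreover have "\<not> comb \<subseteq> mball_of plane tip (real n)"
  proof
    assume "comb \<subseteq> mball_of plane tip (real n)"
    moreover have "0 \<in> comb" unfolding comb_def left_half_def by simp
    ultimately have "dist tip 0 < real n" by auto
    then show False using component_diff_le_dist[of tip 1 0] by (simp add: tip_def)
  qed
  ultimately have "ennreal (\<tau> * (real n)\<^sup>2) \<le> hausdorff2 plane (comb \<inter> mball_of plane tip (real n))"
    using fat n unfolding fat_def by auto
  also have "\<dots> \<le> ennreal (pi * (2 * real (2 * n) * real 3 * 1\<^sup>2))"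
    by (rule hausdorff2_two_rectangles_le[of _ _ 0 "(real n)\<^sup>2 - 1" _ _ 0 "(real n)\<^sup>2 - 1"])
      (use comb_near_tip[of n] n in \<open>auto simp: tip_def\<close>)
  finally have "\<tau> * (real n)\<^sup>2 \<le> pi * (2 * real (2 * n) * real 3 * 1\<^sup>2)"
    by (subst (asm) ennreal_le_iff) auto
  then have "\<tau> * real n * real n \<le> 12 * pi * real n" by (simp add: power2_eq_square)
  then have "\<tau> * real n \<le> 12 * pi" using n by simp
  moreover have "12 * pi < \<tau> * real n" using n assms by (simp add: field_simps)
  ultimately show False by simp
qed

lemma cofat_iff_fat_complement:
  assumes "mspace X = UNIV" "mtopology_of X = euclidean" "connected (- \<Omega>)" "0 < mdiam X (- \<Omega>)"
  shows "cofat X \<Omega> \<longleftrightarrow> (\<exists>\<tau>>0. fat X \<tau> (- \<Omega>))"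
proof -
  have "- \<Omega> \<noteq> {}" using assms(4) by (auto simp: mdiam_def bot_ennreal)
  then have "connected_components_of (top_of_set (- \<Omega>)) = {- \<Omega>}"
    unfolding connected_components_of_eq_singleton null_topspace_iff_trivial[symmetric]
    using assms(3) connectedin_iff_connected[of "- \<Omega>"] by (simp add: connectedin_def)
  then show ?thesis
    unfolding cofat_def assms(1,2) using assms(4) by (simp add: Compl_eq_Diff_UNIV)
qed

theorem mainTheorem5:
  shows "\<exists>(X :: (real^2) metric) (F :: real^2 \<Rightarrow> real^2) (\<Omega> :: (real^2) set).
           ahlfors_2_regular X \<and>
           mtopology_of X homeomorphic_space mtopology_of plane \<and>
           quasiconformal_homeo X plane F \<and>
           domain_in X \<Omega> \<and> cofat X \<Omega> \<and>
           \<not> cofat plane (F ` \<Omega>)"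
proof (intro exI conjI)
  show "ahlfors_2_regular folded_plane" by (rule ahlfors_2_regular_folded_plane)
  show "mtopology_of folded_plane homeomorphic_space mtopology_of plane"
    unfolding mtopology_of_folded_plane by (rule homeomorphic_space_refl)
  show "quasiconformal_homeo folded_plane plane id"
    by (rule agree_below_quasiconformal_id[OF folded_plane_agrees zero_less_one])
  have "vector [1, - 2] \<notin> comb"
    using tooth_height[of "vector [1, - 2]"] unfolding comb_def left_half_def by fastforce
  then show "domain_in folded_plane (- comb)"
    unfolding domain_in_def mtopology_of_folded_plane
    using open_complement_comb connected_complement_comb by auto
  have "0 \<in> comb" "vector [- 1, 0] \<in> comb" unfolding comb_def left_half_def by auto
  then have "0 < mdiam X comb" if "mspace X = UNIV" for X :: "(real^2) metric"
  proof -
    have "(0 :: real^2) \<noteq> vector [- 1, 0]" by (simp add: vec_eq_iff forall_2)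
    then have "mdist X 0 (vector [- 1, 0]) \<noteq> 0" using mdist_zero[of 0 X "vector [- 1, 0]"] that by simp
    then have "0 < ennreal (mdist X 0 (vector [- 1, 0]))"
      using mdist_nonneg[of X 0 "vector [- 1, 0]"] by (simp add: less_le)
    also have "\<dots> \<le> mdiam X comb" by (rule mdist_le_mdiam) fact+
    finally show ?thesis .
  qed
  then have cofat: "cofat X (- comb) \<longleftrightarrow> (\<exists>\<tau>>0. fat X \<tau> comb)"
    if "mspace X = UNIV" "mtopology_of X = euclidean" for X
    using cofat_iff_fat_complement[of X "- comb"] that connected_comb by simp
  show "cofat folded_plane (- comb)"
    by (subst cofat) (use mtopology_of_folded_plane fat_comb_folded_plane in \<open>auto intro!: exI[of _ "1 / 144"]\<close>)
  show "\<not> cofat plane (id ` (- comb))"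
    using cofat[of plane] not_fat_comb_plane by auto
qed

end
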